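(* Let $m_1,m_2$ be positive integers and let $f_1,f_2:\mathbb{N}\to\mathbb{C}$ be two multiplicative functions such that, for each $j\in\{1,2\}$: (i) for some prime $q\mid m_j$, $\sum_{k=0}^\infty \frac{f_j(q^k)}{q^k}=0$; (ii) for each prime power $p^a\,\|\,m_j$ ($p$ prime), $f_j(p^k)=f_j(p^a)$ for all $k\geq a$; (iii) for each prime $p$ with $\gcd(p,m_j)=1$, $f_j(p^k)=1$ for all $k\geq 1$. Let $f=f_1\ast f_2$. Then there exists a constant $d>0$ such that $$\sum_{n\leq x}f(n)=\Omega\left(\exp\left(d\,\frac{\log x}{\log\log x}\right)\right).$$
   Context: $\mathbb{N}=\{1,2,3,\dots\}$. A function $f:\mathbb{N}\to\mathbb{C}$ is multiplicative if $f(1)=1$ and $f(nm)=f(n)f(m)$ whenever $n$ and $m$ are relatively prime. The notation $p^a\,\|\,m$ means that $p^a$ is the largest power of $p$ dividing $m$. $\ast$ denotes Dirichlet convolution, $(f_1\ast f_2)(n)=\sum_{d\mid n}f_1(d)f_2(n/d)$. For a function $S(x)$ and a positive function $g(x)$ (defined for all sufficiently large $x$), $S(x)=\Omega(g(x))$ means $\limsup_{x\to\infty}\frac{|S(x)|}{g(x)}>0$ (possibly $+\infty$). *)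

theory Defs
  imports "HOL-Analysis.Analysis" "HOL-Computational_Algebra.Primes"
begin

text \<open>Arithmetic functions live on the positive integers; they are represented by total functions
  on type nat whose value at 0 is never used.\<close>

definition multiplicative_fun :: "(nat \<Rightarrow> complex) \<Rightarrow> bool" where
  "multiplicative_fun f \<longleftrightarrow>
     f 1 = 1 \<and> (\<forall>n>0. \<forall>m>0. coprime n m \<longrightarrow> f (n * m) = f n * f m)"

definition dirichlet_conv :: "(nat \<Rightarrow> complex) \<Rightarrow> (nat \<Rightarrow> complex) \<Rightarrow> nat \<Rightarrow> complex" where
  "dirichlet_conv f g n = (\<Sum>d | d dvd n. f d * g (n div d))"

definition exact_power_dvd :: "nat \<Rightarrow> nat \<Rightarrow> nat \<Rightarrow> bool" where
  "exact_power_dvd p a m \<longleftrightarrow> p ^ a dvd m \<and> \<not> p ^ Suc a dvd m"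

definition summatory :: "(nat \<Rightarrow> complex) \<Rightarrow> real \<Rightarrow> complex" where
  "summatory f x = (\<Sum>n | 1 \<le> n \<and> real n \<le> x. f n)"

text \<open>This is the Omega of Hardy and Littlewood, a statement about the limit superior, and hence
  weaker than the Landau symbol \<open>\<Omega>\<close> of HOL-Library, which asks for a lower bound for all
  sufficiently large arguments.\<close>

definition HL_Omega :: "(real \<Rightarrow> complex) \<Rightarrow> (real \<Rightarrow> real) \<Rightarrow> bool" where
  "HL_Omega S g \<longleftrightarrow> (\<forall>\<^sub>F x in at_top. g x > 0) \<and> Limsup at_top (\<lambda>x. ereal (norm (S x) / g x)) > 0"

end

theory Submission
  imports Defs "HOL-Real_Asymp.Real_Asymp"
begin

text \<open>
  A single large value of \<open>f = f1 * f2\<close> forces a large partial sum: the value \<open>f N\<close> is the difference of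
  two consecutive partial sums, so one of the sums at \<open>N\<close> and \<open>N - 1\<close> has modulus at least
  \<open>\<bar>f N\<bar> / 2\<close> (\<open>norm_le_norm_summatory\<close>).

  Large values come from numbers with many prime factors. At a prime \<open>p\<close> dividing neither \<open>m1\<close>
  nor \<open>m2\<close> both functions take the value 1, so on products of distinct such primes they agree with the constant
  function 1, whose convolution square counts divisors. If \<open>N\<close> is a product of \<open>K\<close> of them, then
  \<open>f N = 2 ^ K\<close> (\<open>dirichlet_conv_prod_primes\<close>).

  It remains to compare \<open>K\<close> with \<open>ln N / ln (ln N)\<close>. Take all admissible primes up to \<open>Y\<close>. Then
  \<open>ln N \<le> K ln Y\<close>, while \<open>N \<ge> 2 ^ K\<close> gives \<open>ln (ln N) \<ge> ln K + ln (ln 2)\<close>. As soon as \<open>K\<close> exceeds a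
  constant multiple of \<open>sqrt Y\<close>, the latter is at least \<open>(ln Y) / 2\<close> and hence
  \<open>ln N / ln (ln N) \<le> 2 K\<close>. So any lower bound for the number of primes up to \<open>Y\<close> by a power of \<open>Y\<close>
  with exponent above one half suffices; Chebyshev's bound, of order \<open>Y / ln Y\<close>, is proved below
  (\<open>prime_count_ge\<close>), and leaving out the finitely many primes that divide \<open>m1 * m2\<close> does not affect
  it (\<open>exists_many_primes_avoiding\<close>).
\<close>

section \<open>A Chebyshev lower bound for the number of primes\<close>

text \<open>
  This is the integrality of \<open>L\<close> times the entries \<open>1 / (k * (n choose k))\<close> of Leibniz's harmonic
  triangle. The first column consists of the numbers \<open>1 / n\<close>, and each further entry is a difference of
  two entries of the preceding column:
  \<open>1 / ((k+1) * (n choose (k+1))) = 1 / (k * ((n-1) choose k)) - 1 / (k * (n choose k))\<close>.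
\<close>

lemma times_binomial_dvd_common_multiple:
  fixes L :: nat
  assumes "1 \<le> k" "k \<le> n" and "\<And>i. 1 \<le> i \<Longrightarrow> i \<le> n \<Longrightarrow> i dvd L"
  shows "k * (n choose k) dvd L"
  using assms
proof (induction k arbitrary: n rule: nat_induct_at_least)
  case base
  then show ?case by simp
next
  case (Suc k)
  obtain m where n: "n = Suc m" "k \<le> m"
    using Suc.prems(1) by (metis Suc_le_D Suc_le_mono)
  have "k * (m choose k) dvd L"
    using n Suc.prems by (intro Suc.IH) auto
  then obtain a where a: "L = k * (m choose k) * a" by (elim dvdE)
  have "k * (n choose k) dvd L"
    using n Suc.prems by (intro Suc.IH) auto
  then obtain b where b: "L = k * (n choose k) * b" by (elim dvdE)
  \<comment> \<open>The recursion predicts that the cofactor of \<open>X\<close> in \<open>L\<close> is \<open>a - b\<close>.\<close>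
  define X where "X = int (Suc k * (n choose Suc k))"
  have X1: "X = int n * int (m choose k)"
  proof -
    have "Suc k * (n choose Suc k) = n * (m choose k)"
      unfolding n by (rule Suc_times_binomial)
    then show ?thesis unfolding X_def by (simp only: of_nat_mult)
  qed
  have X2: "X = (int n - int k) * int (n choose k)"
  proof -
    have "Suc k * (n choose Suc k) = (n - k) * (n choose k)"
      using n by (metis binomial_absorb_comp binomial_absorption diff_Suc_1 mult.commute)
    then show ?thesis
      unfolding X_def using n by (simp only: of_nat_mult of_nat_diff)
  qed
  have "int k * int L = int k * (X * (int a - int b))"
  proof -
    have "int k * (X * int a) = int n * int L"
      unfolding X1 by (subst a) simp
    moreover have "int k * (X * int b) = (int n - int k) * int L"
      unfolding X2 by (subst b) simp
    ultimately show ?thesis by (simp add: algebra_simps)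
  qed
  then have "int L = X * (int a - int b)"
    using Suc.hyps by simp
  then have "X dvd int L" by simp
  then show ?case unfolding X_def by (simp only: int_dvd_int_iff)
qed

text \<open>
  The witness is the least common multiple of \<open>1, ..., n\<close>, written as the product over the primes
  \<open>p \<le> n\<close> of the largest power of \<open>p\<close> not exceeding \<open>n\<close>; each of these factors is at most \<open>n\<close>.
\<close>

lemma exists_common_multiple_le_power:
  assumes "n \<ge> 1"
  shows "\<exists>L::nat. 0 < L \<and> L \<le> n ^ card {p. prime p \<and> p \<le> n} \<and> (\<forall>i. 1 \<le> i \<longrightarrow> i \<le> n \<longrightarrow> i dvd L)"
proof -
  define P where "P = {p::nat. prime p \<and> p \<le> n}"
  have fin: "finite P" unfolding P_def by simp
  define e where "e p = (GREATEST v. p ^ v \<le> n)" for p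
  have bound: "v \<le> n" if "prime p" "p ^ v \<le> n" for p v
  proof -
    have "v < 2 ^ v" by simp
    also have "\<dots> \<le> p ^ v" using that(1) by (intro power_mono prime_ge_2_nat) auto
    finally show ?thesis using that by simp
  qed
  have e_le: "p ^ e p \<le> n" if "prime p" for p
    unfolding e_def
    by (rule GreatestI_nat[where k = 0 and b = n]) (use assms bound that in auto)
  have e_max: "v \<le> e p" if "prime p" "p ^ v \<le> n" for p v
    unfolding e_def using that bound by (intro Greatest_le_nat[where b = n]) auto
  define L where "L = (\<Prod>p\<in>P. p ^ e p)"
  have "L \<noteq> 0"
    unfolding L_def using fin by (auto simp: P_def prime_gt_0_nat)
  moreover have "L \<le> n ^ card P"
  proof -
    have "L \<le> (\<Prod>p\<in>P. n)"
      unfolding L_def by (intro prod_mono) (auto simp: P_def e_le)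
    then show ?thesis by simp
  qed
  moreover have "i dvd L" if i: "1 \<le> i" "i \<le> n" for i
  proof -
    have sub: "prime_factors i \<subseteq> P"
      using i by (force simp: P_def dest: dvd_imp_le)
    have "i = (\<Prod>p\<in>prime_factors i. p ^ multiplicity p i)"
      using i by (intro prime_factorization_nat) auto
    also have "\<dots> dvd L"
      unfolding L_def
    proof (rule prod_dvd_prod_subset2[OF fin sub])
      fix p assume p: "p \<in> prime_factors i"
      have "p ^ multiplicity p i \<le> i"
        using i by (intro dvd_imp_le multiplicity_dvd) auto
      then have "multiplicity p i \<le> e p"
        using p i by (intro e_max) auto
      then show "p ^ multiplicity p i dvd p ^ e p"
        by (rule le_imp_power_dvd)
    qed
    finally show ?thesis .
  qed
  ultimately show ?thesis unfolding P_def by blast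
qed

text \<open>
  The central binomial coefficient is at least \<open>4 ^ n / (2 * n)\<close>, yet its product with \<open>n\<close> divides
  a common multiple of \<open>1, ..., 2 * n\<close> that is bounded by a power of \<open>2 * n\<close> whose exponent counts primes.
\<close>

lemma four_power_le_power_prime_count:
  assumes "n \<ge> 1"
  shows "4 ^ n \<le> 2 * (2 * n) ^ card {p. prime p \<and> p \<le> 2 * n}"
proof -
  obtain L where L: "0 < L" "L \<le> (2 * n) ^ card {p. prime p \<and> p \<le> 2 * n}"
    "\<And>i. 1 \<le> i \<Longrightarrow> i \<le> 2 * n \<Longrightarrow> i dvd L"
    using exists_common_multiple_le_power[of "2 * n"] assms by auto
  have "n * (2 * n choose n) dvd L"
    using assms L(3) by (intro times_binomial_dvd_common_multiple) auto
  then have le: "n * (2 * n choose n) \<le> L"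
    using L(1) by (rule dvd_imp_le)
  have "4 ^ n / (2 * real n) \<le> real (2 * n choose n)"
    using assms by (intro central_binomial_lower_bound) auto
  then have "real (4 ^ n) \<le> real (2 * (n * (2 * n choose n)))"
    using assms by (simp add: field_simps)
  then have "4 ^ n \<le> 2 * (n * (2 * n choose n))"
    by (simp only: of_nat_le_iff)
  then show ?thesis using le L(2) by linarith
qed

lemma prime_count_ge:
  assumes "n \<ge> 2"
  shows "(2 * real n - 1) * ln 2 / ln (2 * real n) \<le> card {p. prime p \<and> p \<le> 2 * n}"
proof -
  define k where "k = card {p. prime p \<and> p \<le> 2 * n}"
  have "real (4 ^ n) \<le> real (2 * (2 * n) ^ k)"
    using four_power_le_power_prime_count[of n] assms unfolding k_def by (simp only: of_nat_le_iff)
  then have "ln ((2::real) ^ (2 * n)) \<le> ln (2 * (2 * real n) ^ k)"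
    using assms by (subst ln_le_cancel_iff) (auto simp: power_mult)
  also have "\<dots> = ln 2 + k * ln (2 * real n)"
    using assms ln_realpow[of "2 * real n" k] ln_mult[of 2 "(2 * real n) ^ k"]
    by (simp del: power_mult_distrib)
  finally have "(2 * real n - 1) * ln 2 \<le> k * ln (2 * real n)"
    by (simp add: ln_realpow algebra_simps)
  then show ?thesis
    unfolding k_def using assms by (subst pos_divide_le_eq) auto
qed

text \<open>
  The last inequality is the form in which the prime count enters the comparison of sizes:
  \<open>(card P - 1) * ln 2\<close> is a lower bound for the logarithm of \<open>\<Prod>P - 1\<close>, so the iterated logarithm will
  be at least half of \<open>ln Y\<close>. The parameter \<open>B\<close> makes the construction arbitrarily large.
\<close>

lemma exists_many_primes_avoiding:
  assumes "M > (0::nat)"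
  shows "\<exists>P Y. finite P \<and> (\<forall>p\<in>P. prime p \<and> \<not> p dvd M \<and> real p \<le> Y) \<and> Y \<ge> 2 \<and> Y \<ge> B \<and>
           sqrt Y \<le> (real (card P) - 1) * ln 2"
proof -
  define c where "c = real (card (prime_factors M))"
  have "\<forall>\<^sub>F x::real in at_top. sqrt x \<le> ((x - 1) * ln 2 / ln x - c - 1) * ln 2"
    by real_asymp
  then obtain X where X: "\<And>x. x \<ge> X \<Longrightarrow> sqrt x \<le> ((x - 1) * ln 2 / ln x - c - 1) * ln 2"
    unfolding eventually_at_top_linorder by blast
  obtain n where "max 2 (max B X) \<le> real n"
    using real_arch_simple by blast
  then have n: "real n \<ge> 2" "real n \<ge> B" "real n \<ge> X" by simp_all
  define P where "P = {p. prime p \<and> p \<le> 2 * n} - prime_factors M"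
  have "card {p. prime p \<and> p \<le> 2 * n} - card (prime_factors M) \<le> card P"
    unfolding P_def by (rule diff_card_le_card_Diff) simp
  then have "(2 * real n - 1) * ln 2 / ln (2 * real n) - c \<le> real (card P)"
    using prime_count_ge[of n] n unfolding c_def by linarith
  then have "((2 * real n - 1) * ln 2 / ln (2 * real n) - c - 1) * ln 2 \<le> (real (card P) - 1) * ln 2"
    by (intro mult_right_mono) auto
  moreover have "sqrt (2 * real n) \<le> ((2 * real n - 1) * ln 2 / ln (2 * real n) - c - 1) * ln 2"
    using n by (intro X) simp
  ultimately have "sqrt (2 * real n) \<le> (real (card P) - 1) * ln 2"
    by (rule order_trans[rotated])
  moreover have "finite P" unfolding P_def by simp
  moreover have "\<forall>p\<in>P. prime p \<and> \<not> p dvd M \<and> real p \<le> 2 * real n"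
    using assms unfolding P_def by (auto simp: prime_factors_dvd)
  moreover have "2 * real n \<ge> 2" "2 * real n \<ge> B"
    using n by simp_all
  ultimately show ?thesis by blast
qed

section \<open>Values at products of distinct primes\<close>

lemma prime_dvd_prod_primes_iff:
  fixes p :: nat
  assumes "finite Q" "\<And>q. q \<in> Q \<Longrightarrow> prime q" "prime p"
  shows "p dvd \<Prod>Q \<longleftrightarrow> p \<in> Q"
proof
  assume "p dvd \<Prod>Q"
  then obtain q where "q \<in> Q" "p dvd q"
    using assms(1,3) by (auto simp: prime_dvd_prod_iff)
  then show "p \<in> Q"
    using assms(2,3) primes_dvd_imp_eq by blast
next
  assume "p \<in> Q"
  then show "p dvd \<Prod>Q"
    using assms(1) dvd_prodI[of Q p "\<lambda>q. q"] by simp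
qed

text \<open>Surjectivity is by induction on \<open>P\<close>: a divisor of \<open>p * \<Prod>P\<close> splits into a divisor of \<open>p\<close>, which is
  1 or \<open>p\<close>, and a divisor of \<open>\<Prod>P\<close>.\<close>

lemma bij_betw_Prod_Pow_divisors:
  fixes P :: "nat set"
  assumes "finite P" "\<And>p. p \<in> P \<Longrightarrow> prime p"
  shows "bij_betw (\<lambda>Q. \<Prod>Q) (Pow P) {d. d dvd \<Prod>P}"
proof (rule bij_betw_imageI)
  show "inj_on (\<lambda>Q. \<Prod>Q) (Pow P)"
  proof (rule inj_onI)
    fix Q R assume QR: "Q \<in> Pow P" "R \<in> Pow P" "\<Prod>Q = \<Prod>R"
    have "p \<in> Q \<longleftrightarrow> p \<in> R" if "p \<in> P" for p
      using prime_dvd_prod_primes_iff[of Q p] prime_dvd_prod_primes_iff[of R p] QR assms that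
      by (metis PowD finite_subset subsetD)
    then show "Q = R" using QR by auto
  qed
  show "(\<lambda>Q. \<Prod>Q) ` Pow P = {d. d dvd \<Prod>P}"
  proof (intro equalityI subsetI)
    fix d assume "d \<in> (\<lambda>Q. \<Prod>Q) ` Pow P"
    then show "d \<in> {d. d dvd \<Prod>P}"
      using assms(1) by (auto intro: prod_dvd_prod_subset)
  next
    fix d assume "d \<in> {d. d dvd \<Prod>P}"
    then have "d dvd \<Prod>P" by simp
    with assms have "\<exists>Q\<subseteq>P. d = \<Prod>Q"
    proof (induction P arbitrary: d rule: finite_induct)
      case empty
      then show ?case by auto
    next
      case (insert p P)
      have "d dvd p * \<Prod>P" using insert by simp
      then obtain b c where bc: "d = b * c" "b dvd p" "c dvd \<Prod>P"
        by (rule dvd_productE)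
      obtain Q where Q: "Q \<subseteq> P" "c = \<Prod>Q"
        using insert.IH[OF _ bc(3)] insert.prems by auto
      have "b = 1 \<or> b = p"
        using bc(2) insert.prems by (auto simp: prime_nat_iff)
      moreover have "\<Prod>(insert p Q) = p * \<Prod>Q"
        using Q insert.hyps by (subst prod.insert) (auto intro: finite_subset)
      ultimately show ?case
        using Q bc(1) by (metis insert_mono mult_1 subset_insertI2)
    qed
    then show "d \<in> (\<lambda>Q. \<Prod>Q) ` Pow P" by auto
  qed
qed

lemma multiplicative_fun_prod_primes:
  assumes "multiplicative_fun f" "finite Q"
    and "\<And>p. p \<in> Q \<Longrightarrow> prime p" "\<And>p. p \<in> Q \<Longrightarrow> f p = 1"
  shows "f (\<Prod>Q) = 1"
  using assms(2-4)
proof (induction Q rule: finite_induct)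
  case empty
  then show ?case using assms(1) by (simp add: multiplicative_fun_def)
next
  case (insert p Q)
  have "coprime p (\<Prod>Q)"
    using insert.prems insert.hyps
    by (intro prod_coprime_right primes_coprime) auto
  moreover have "\<Prod>Q > 0" "p > 0"
    using insert.prems by (auto intro!: prod_pos simp: prime_gt_0_nat)
  ultimately have "f (p * \<Prod>Q) = f p * f (\<Prod>Q)"
    using assms(1) by (simp add: multiplicative_fun_def)
  then show ?case using insert by simp
qed

text \<open>Both factors are 1 at every divisor of \<open>\<Prod>P\<close>, so the convolution counts the divisors, which correspond
  to the subsets of \<open>P\<close>.\<close>

lemma dirichlet_conv_prod_primes:
  assumes "multiplicative_fun f" "multiplicative_fun g" "finite P"
    and prime: "\<And>p. p \<in> P \<Longrightarrow> prime p"
    and "\<And>p. p \<in> P \<Longrightarrow> f p = 1" "\<And>p. p \<in> P \<Longrightarrow> g p = 1"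
  shows "dirichlet_conv f g (\<Prod>P) = 2 ^ card P"
proof -
  have "dirichlet_conv f g (\<Prod>P) = (\<Sum>Q\<in>Pow P. f (\<Prod>Q) * g (\<Prod>P div \<Prod>Q))"
    unfolding dirichlet_conv_def
    using bij_betw_Prod_Pow_divisors[OF assms(3) prime]
    by (rule sum.reindex_bij_betw[symmetric])
  also have "\<dots> = (\<Sum>Q\<in>Pow P. 1)"
  proof (rule sum.cong)
    fix Q assume "Q \<in> Pow P"
    then have Q: "Q \<subseteq> P" "finite Q" using assms(3) finite_subset by auto
    have "\<Prod>P = \<Prod>(P - Q) * \<Prod>Q"
      using Q assms(3) by (intro prod.subset_diff)
    moreover have "\<Prod>Q > 0"
      using Q prime by (intro prod_pos) (auto simp: prime_gt_0_nat)
    ultimately have "\<Prod>P div \<Prod>Q = \<Prod>(P - Q)" by simp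
    moreover have "f (\<Prod>Q) = 1"
      by (rule multiplicative_fun_prod_primes[OF assms(1)]) (use Q assms(4,5) in blast)+
    moreover have "g (\<Prod>(P - Q)) = 1"
      by (rule multiplicative_fun_prod_primes[OF assms(2)]) (use assms(3,4,6) in blast)+
    ultimately show "f (\<Prod>Q) * g (\<Prod>P div \<Prod>Q) = 1" by simp
  qed simp
  also have "\<dots> = 2 ^ card P"
    using assms(3) by (simp add: card_Pow)
  finally show ?thesis .
qed

section \<open>From large values to an Omega result\<close>

lemma norm_le_norm_summatory:
  assumes "N \<ge> 1"
  shows "norm (f N) \<le> norm (summatory f (real N)) + norm (summatory f (real (N - 1)))"
proof -
  have "{n. 1 \<le> n \<and> real n \<le> real N} = insert N {n. 1 \<le> n \<and> real n \<le> real (N - 1)}"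
    using assms by auto
  moreover have "finite {n. 1 \<le> n \<and> real n \<le> real (N - 1)}"
    by (rule finite_subset[of _ "{..N}"]) auto
  ultimately have "summatory f (real N) = f N + summatory f (real (N - 1))"
    using assms unfolding summatory_def by (simp add: sum.insert)
  then have "f N = summatory f (real N) - summatory f (real (N - 1))" by simp
  then show ?thesis by (metis norm_triangle_ineq4)
qed

lemma HL_Omega_of_arbitrarily_large_witnesses:
  assumes pos: "\<And>x. g x > 0" and "c > 0"
    and wit: "\<And>B. \<exists>x\<ge>B. norm (S x) \<ge> c * g x"
  shows "HL_Omega S g"
proof -
  have "Limsup at_top (\<lambda>x. ereal (norm (S x) / g x)) \<ge> ereal c"
  proof (rule ccontr)
    assume "\<not> ?thesis"
    then have "\<forall>\<^sub>F x in at_top. ereal (norm (S x) / g x) < ereal c"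
      by (intro Limsup_lessD) simp
    then obtain B where B: "\<And>x. x \<ge> B \<Longrightarrow> norm (S x) / g x < c"
      unfolding eventually_at_top_linorder by auto
    obtain x where "x \<ge> B" "norm (S x) \<ge> c * g x" using wit by blast
    then show False using B[of x] pos[of x] by (simp add: field_simps)
  qed
  then have "Limsup at_top (\<lambda>x. ereal (norm (S x) / g x)) > 0"
    using \<open>c > 0\<close> by (meson ereal_less(2) less_le_trans)
  then show ?thesis
    unfolding HL_Omega_def using pos by simp
qed

theorem theorem1p3:
  fixes m1 m2 :: nat and f1 f2 :: "nat \<Rightarrow> complex"
  assumes "m1 > 0" and "m2 > 0"
    and "multiplicative_fun f1" and "multiplicative_fun f2"
    and "\<exists>q. prime q \<and> q dvd m1 \<and> (\<lambda>k. f1 (q ^ k) / of_nat (q ^ k)) sums 0"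
    and "\<exists>q. prime q \<and> q dvd m2 \<and> (\<lambda>k. f2 (q ^ k) / of_nat (q ^ k)) sums 0"
    and "\<And>p a k. prime p \<Longrightarrow> a \<ge> 1 \<Longrightarrow> exact_power_dvd p a m1 \<Longrightarrow> k \<ge> a \<Longrightarrow> f1 (p ^ k) = f1 (p ^ a)"
    and "\<And>p a k. prime p \<Longrightarrow> a \<ge> 1 \<Longrightarrow> exact_power_dvd p a m2 \<Longrightarrow> k \<ge> a \<Longrightarrow> f2 (p ^ k) = f2 (p ^ a)"
    and "\<And>p k. prime p \<Longrightarrow> coprime p m1 \<Longrightarrow> k \<ge> 1 \<Longrightarrow> f1 (p ^ k) = 1"
    and "\<And>p k. prime p \<Longrightarrow> coprime p m2 \<Longrightarrow> k \<ge> 1 \<Longrightarrow> f2 (p ^ k) = 1"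
  shows "\<exists>d::real. d > 0 \<and>
    HL_Omega (summatory (dirichlet_conv f1 f2)) (\<lambda>x. exp (d * (ln x / ln (ln x))))"
proof -
  define f where "f = dirichlet_conv f1 f2"
  define g where "g x = exp (ln 2 / 2 * (ln x / ln (ln x)))" for x :: real
  \<comment> \<open>The exponent \<open>ln 2 / 2\<close> turns \<open>ln x / ln (ln x) \<le> 2 * K\<close> into \<open>g x \<le> 2 ^ K\<close>.\<close>
  have val: "f1 p = 1" "f2 p = 1" if "prime p" "\<not> p dvd m1 * m2" for p
  proof -
    have "coprime p m1" "coprime p m2"
      using that by (auto intro!: prime_imp_coprime)
    then show "f1 p = 1" "f2 p = 1"
      using that(1) assms(9)[of p 1] assms(10)[of p 1] by simp_all
  qed
  have "\<exists>x\<ge>B. norm (summatory f x) \<ge> 1 / 2 * g x" for B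
  proof -
    obtain P Y where P: "finite P" "\<And>p. p \<in> P \<Longrightarrow> prime p" "\<And>p. p \<in> P \<Longrightarrow> \<not> p dvd m1 * m2"
        "\<And>p. p \<in> P \<Longrightarrow> real p \<le> Y"
      and Y: "Y \<ge> 2" "Y \<ge> (max B 1)\<^sup>2" "sqrt Y \<le> (real (card P) - 1) * ln 2"
      using exists_many_primes_avoiding[of "m1 * m2" "(max B 1)\<^sup>2"] assms(1,2) by auto
    define K where "K = card P"
    define N where "N = \<Prod>P"
    have "sqrt Y > 0" using Y(1) by simp
    then have "0 < (real K - 1) * ln 2" using Y(3) unfolding K_def by linarith
    then have "real K > 1" by (simp add: zero_less_mult_iff)
    then have K: "K \<ge> 2" by linarith
    have N_lower: "2 ^ K \<le> N"
    proof -
      have "(\<Prod>p\<in>P. 2) \<le> N"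
        unfolding N_def using P(2) by (intro prod_mono) (auto simp: prime_ge_2_nat)
      then show ?thesis unfolding K_def by simp
    qed
    have N_upper: "real N \<le> Y ^ K"
    proof -
      have "real N = (\<Prod>p\<in>P. real p)" unfolding N_def by simp
      also have "\<dots> \<le> (\<Prod>p\<in>P. Y)" using P(4) by (intro prod_mono) auto
      finally show ?thesis unfolding K_def by simp
    qed
    have "f N = 2 ^ K"
      unfolding f_def N_def K_def
      by (rule dirichlet_conv_prod_primes[OF assms(3,4) P(1)]) (use P(2,3) val in blast)+
    then have fN: "norm (f N) = 2 ^ K" by (simp add: norm_power)
    \<comment> \<open>The large partial sum may occur at \<open>N\<close> or at \<open>N - 1\<close>, so the bound on \<open>g\<close> has to cover both points.\<close>
    have near: "x \<ge> B \<and> g x \<le> 2 ^ K" if x: "x \<le> real N" "real N - 1 \<le> x" for x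
    proof -
      \<comment> \<open>Passing to \<open>N - 1\<close> costs at most a factor 2, which is why \<open>card P - 1\<close> appears in the choice of \<open>P\<close>.\<close>
      have "(2::real) ^ K \<le> real N"
        using N_lower by (metis of_nat_le_iff of_nat_numeral of_nat_power)
      moreover have "(2::real) ^ K = 2 * 2 ^ (K - 1)"
        using K by (cases K) auto
      moreover have "(2::real) ^ (K - 1) \<ge> 1" by simp
      ultimately have x_lower: "2 ^ (K - 1) \<le> x" using x by linarith
      have x1: "x > 0" using x_lower by (smt (verit) zero_less_power)
      have "sqrt Y \<le> ln ((2::real) ^ (K - 1))"
        using Y(3) K unfolding K_def[symmetric] by (simp add: ln_realpow of_nat_diff)
      also have "\<dots> \<le> ln x"
        using x_lower x1 by (subst ln_le_cancel_iff) auto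
      finally have lnx: "sqrt Y \<le> ln x" .
      have "max B 1 \<le> sqrt Y"
        using Y(2) by (intro real_le_rsqrt)
      moreover have "ln x \<le> x" using ln_le_minus_one[OF x1] by linarith
      ultimately have xB: "x \<ge> B" using lnx by linarith
      have "ln (sqrt Y) \<le> ln (ln x)"
        using lnx \<open>sqrt Y > 0\<close> by (intro ln_mono)
      then have lnln: "ln Y / 2 \<le> ln (ln x)"
        using Y(1) by (simp add: ln_sqrt)
      have lnY: "ln Y > 0" using Y(1) by simp
      have "ln x \<le> ln (Y ^ K)"
        using x N_upper x1 by (subst ln_le_cancel_iff) auto
      also have "\<dots> = 2 * K * (ln Y / 2)" using Y(1) by (simp add: ln_realpow)
      also have "\<dots> \<le> 2 * K * ln (ln x)"
        using lnln by (intro mult_left_mono) auto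
      finally have "ln x / ln (ln x) \<le> 2 * K"
        using lnln lnY by (subst pos_divide_le_eq) auto
      then have "ln 2 / 2 * (ln x / ln (ln x)) \<le> ln 2 / 2 * (2 * real K)"
        by (intro mult_left_mono) auto
      then have "g x \<le> exp (real K * ln 2)"
        unfolding g_def by (simp add: mult.commute)
      also have "\<dots> = 2 ^ K" by (simp add: exp_of_nat_mult)
      finally show ?thesis using xB by blast
    qed
    have N1: "N \<ge> 1" using N_lower by (meson one_le_numeral one_le_power order_trans)
    have "2 ^ K \<le> norm (summatory f (real N)) + norm (summatory f (real (N - 1)))"
      using norm_le_norm_summatory[OF N1, of f] fN by simp
    then consider "1 / 2 * 2 ^ K \<le> norm (summatory f (real N))"
      | "1 / 2 * 2 ^ K \<le> norm (summatory f (real (N - 1)))"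
      by linarith
    then show ?thesis
    proof cases
      case 1
      then show ?thesis using near[of "real N"] by (intro exI[of _ "real N"]) auto
    next
      case 2
      then show ?thesis
        using near[of "real (N - 1)"] N1 by (intro exI[of _ "real (N - 1)"]) (auto simp: of_nat_diff)
    qed
  qed
  then have "HL_Omega (summatory f) g"
    by (intro HL_Omega_of_arbitrarily_large_witnesses[where c = "1 / 2"]) (auto simp: g_def)
  then show ?thesis
    unfolding f_def g_def by (intro exI[of _ "ln 2 / 2"]) simp
qed

end
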